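(* Let $f$ be an orientation-preserving harmonic mapping in $\mathbb D$ with $\|\omega_f\|_\infty<1$. For an orientation-preserving real-affine mapping $A$ minimizing $K(A\circ f)$, define $$\mathscr B[f](z)=\frac{A(f(z))-A(f(0))}{(A\circ f)_z(0)}.$$ This definition is independent of the chosen minimizing affine mapping $A$. Moreover, for every orientation-preserving real-affine mapping $B$, $$\mathscr B[B\circ f]=\mathscr B[f].$$ Thus $\mathscr B$ is a canonical section of the target-affine quotient (the quotient of the set of such $f$ by the relation $f\sim B\circ f$), normalized by $\mathscr B[f](0)=0$ and $\mathscr B[f]_z(0)=1$.
   Context: $\mathbb D$ is the open unit disk in $\mathbb C$. An orientation-preserving harmonic mapping in $\mathbb D$ is a complex-valued harmonic function $f=h+\overline g$, with $h,g$ analytic in $\mathbb D$, whose Jacobian $|h'|^2-|g'|^2$ is positive everywhere; its complex dilatation $\omega_f=g'/h'$ is an analytic map $\mathbb D\to\mathbb D$. $\|\cdot\|_\infty$ is the supremum norm on $\mathbb D$, and $K(f)=\frac{1+\|\omega_f\|_\infty}{1-\|\omega_f\|_\infty}$. An orientation-preserving real-affine mapping is $A(w)=aw+b\overline w+c$ with $a,b,c\in\mathbb C$, $|a|>|b|$; $A\circ f$ is again an orientation-preserving harmonic mapping with $\|\omega_{A\circ f}\|_\infty<1$. "Minimizing" means that $A$ attains $\inf_{A'}K(A'\circ f)$ over all orientation-preserving real-affine $A'$; minimizing mappings exist. Subscript $z$ denotes the Wirtinger derivative $\partial/\partial z$. *)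

theory Defs
  imports "HOL-Complex_Analysis.Complex_Analysis"
begin

abbreviation unit_disk :: "complex set" ("\<D>")
  where "\<D> \<equiv> ball 0 1"

text \<open>
  Mappings on the disk are represented by functions in \<open>extensional \<D>\<close>, so that
  equality of functions is equality on the disk; accordingly the composition \<open>A \<circ> f\<close> is
  \<open>compose \<D> A f\<close>.
\<close>

text \<open>The operators \<open>\<partial>/\<partial>z = (\<partial>/\<partial>x - \<i> \<partial>/\<partial>y)/2\<close> and \<open>\<partial>/\<partial>z\<close>-bar \<open>= (\<partial>/\<partial>x + \<i> \<partial>/\<partial>y)/2\<close>.\<close>

definition wirtinger :: "(complex \<Rightarrow> complex) \<Rightarrow> complex \<Rightarrow> complex" where
  "wirtinger f z =
     (frechet_derivative f (at z) 1 - \<i> * frechet_derivative f (at z) \<i>) / 2"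

definition wirtinger_bar :: "(complex \<Rightarrow> complex) \<Rightarrow> complex \<Rightarrow> complex" where
  "wirtinger_bar f z =
     (frechet_derivative f (at z) 1 + \<i> * frechet_derivative f (at z) \<i>) / 2"

definition harmonic_decomp ::
  "(complex \<Rightarrow> complex) \<Rightarrow> (complex \<Rightarrow> complex) \<Rightarrow> (complex \<Rightarrow> complex) \<Rightarrow> bool" where
  "harmonic_decomp f h g \<longleftrightarrow>
     h holomorphic_on \<D> \<and> g holomorphic_on \<D> \<and> (\<forall>z\<in>\<D>. f z = h z + cnj (g z))"

definition op_harmonic :: "(complex \<Rightarrow> complex) set" where
  "op_harmonic = {f \<in> extensional \<D>.
     \<exists>h g. harmonic_decomp f h g \<and>
           (\<forall>z\<in>\<D>. (cmod (deriv h z))\<^sup>2 - (cmod (deriv g z))\<^sup>2 > 0)}"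

text \<open>
  The functions \<open>h\<close> and \<open>g\<close> are determined by \<open>f\<close> only up to additive constants, but their
  derivatives on the disk are unique, see \<open>dilatation_eq\<close> below.
\<close>

definition dilatation :: "(complex \<Rightarrow> complex) \<Rightarrow> complex \<Rightarrow> complex" where
  "dilatation f z = (THE w. \<exists>h g. harmonic_decomp f h g \<and> w = deriv g z / deriv h z)"

definition disk_sup_norm :: "(complex \<Rightarrow> complex) \<Rightarrow> real" where
  "disk_sup_norm u = (SUP z\<in>\<D>. cmod (u z))"

text \<open>Meaningful only when the norm of the dilatation is less than 1.\<close>

definition max_dilatation :: "(complex \<Rightarrow> complex) \<Rightarrow> real" where
  "max_dilatation f =
     (1 + disk_sup_norm (dilatation f)) / (1 - disk_sup_norm (dilatation f))"

definition qc_harmonic :: "(complex \<Rightarrow> complex) set" where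
  "qc_harmonic = {f \<in> op_harmonic. disk_sup_norm (dilatation f) < 1}"

definition op_affine :: "(complex \<Rightarrow> complex) set" where
  "op_affine = {A. \<exists>a b c. cmod a > cmod b \<and> A = (\<lambda>w. a * w + b * cnj w + c)}"

definition minimizing :: "(complex \<Rightarrow> complex) \<Rightarrow> (complex \<Rightarrow> complex) \<Rightarrow> bool" where
  "minimizing f A \<longleftrightarrow>
     is_arg_min (\<lambda>A'. max_dilatation (compose \<D> A' f)) (\<lambda>A'. A' \<in> op_affine) A"

definition affine_normalization ::
  "(complex \<Rightarrow> complex) \<Rightarrow> (complex \<Rightarrow> complex) \<Rightarrow> complex \<Rightarrow> complex" where
  "affine_normalization A f =
     (\<lambda>z\<in>\<D>. (A (f z) - A (f 0)) / wirtinger (compose \<D> A f) 0)"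

text \<open>The operator \<open>\<B>\<close>, for an arbitrary choice of the minimizing affine mapping.\<close>

definition canonical_rep :: "(complex \<Rightarrow> complex) \<Rightarrow> complex \<Rightarrow> complex" ("\<B>") where
  "\<B> f = affine_normalization (SOME A. minimizing f A) f"

definition target_affine_rel :: "((complex \<Rightarrow> complex) \<times> (complex \<Rightarrow> complex)) set" where
  "target_affine_rel =
     {(f, k). f \<in> qc_harmonic \<and> k \<in> qc_harmonic \<and> (\<exists>B\<in>op_affine. k = compose \<D> B f)}"

text \<open>A right inverse of the projection from \<open>X\<close> onto \<open>X // R\<close>.\<close>

definition quotient_section :: "'a set \<Rightarrow> ('a \<times> 'a) set \<Rightarrow> ('a set \<Rightarrow> 'a) \<Rightarrow> bool" where
  "quotient_section X R s \<longleftrightarrow> s \<in> X // R \<rightarrow> X \<and> (\<forall>q\<in>X // R. R `` {s q} = q)"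

lemma harmonic_decomp_frechet_derivative:
  assumes "harmonic_decomp f h g" and z: "z \<in> \<D>"
  shows "frechet_derivative f (at z) = (\<lambda>v. deriv h z * v + cnj (deriv g z * v))"
proof -
  have hg: "h holomorphic_on \<D>" "g holomorphic_on \<D>"
    and f: "\<And>w. w \<in> \<D> \<Longrightarrow> f w = h w + cnj (g w)"
    using assms(1) unfolding harmonic_decomp_def by auto
  have "(h has_derivative (\<lambda>v. deriv h z * v)) (at z)"
    using holomorphic_derivI[OF hg(1) open_ball z]
    by (simp add: has_field_derivative_def)
  moreover have "(g has_derivative (\<lambda>v. deriv g z * v)) (at z)"
    using holomorphic_derivI[OF hg(2) open_ball z]
    by (simp add: has_field_derivative_def)
  ultimately have "((\<lambda>w. h w + cnj (g w)) has_derivative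
      (\<lambda>v. deriv h z * v + cnj (deriv g z * v))) (at z)"
    by (intro has_derivative_add has_derivative_cnj)
  then have "(f has_derivative (\<lambda>v. deriv h z * v + cnj (deriv g z * v))) (at z)"
    by (rule has_derivative_transform_within_open[OF _ open_ball z]) (simp add: f)
  then show ?thesis
    by (rule frechet_derivative_at[symmetric])
qed

lemma wirtinger_eq:
  assumes "harmonic_decomp f h g" and "z \<in> \<D>"
  shows "wirtinger f z = deriv h z" and "wirtinger_bar f z = cnj (deriv g z)"
  by (simp_all add: wirtinger_def wirtinger_bar_def
      harmonic_decomp_frechet_derivative[OF assms] algebra_simps)

lemma dilatation_eq:
  assumes "harmonic_decomp f h g" and "z \<in> \<D>"
  shows "dilatation f z = deriv g z / deriv h z"
  unfolding dilatation_def
proof (rule the_equality)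
  show "\<exists>h' g'. harmonic_decomp f h' g' \<and> deriv g z / deriv h z = deriv g' z / deriv h' z"
    using assms(1) by blast
next
  fix w
  assume "\<exists>h' g'. harmonic_decomp f h' g' \<and> w = deriv g' z / deriv h' z"
  then obtain h' g' where d: "harmonic_decomp f h' g'" and w: "w = deriv g' z / deriv h' z"
    by blast
  have "deriv h' z = deriv h z" "deriv g' z = deriv g z"
    using wirtinger_eq[OF d assms(2)] wirtinger_eq[OF assms] by simp_all
  then show "w = deriv g z / deriv h z"
    using w by simp
qed

end

theory Submission
  imports Defs
begin

text \<open>
  Up to a similarity, \<open>A w = a w + b w\<^sup>* + c\<close> is determined by \<open>p = -(b / a)\<^sup>*\<close>, where the star denotes
  conjugation, and the dilatation of \<open>A \<circ> f\<close> has the same modulus as the disk automorphism taking \<open>p\<close>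
  to 0, applied to the dilatation of \<open>f\<close>. Hence \<open>A\<close> is minimizing iff \<open>p\<close> is a
  hyperbolic circumcentre of the range of the dilatation of \<open>f\<close>, a set that is relatively
  compact in the disk. Such a centre exists by compactness. It is unique because the
  hyperbolic cosine of the distance to a point is linear on the hyperboloid, and a sum of two distinct
  vectors there has Lorentz norm greater than 2, so that the midpoint of two centres
  would be strictly better. So \<open>A\<close> is unique up to a similarity, which the normalization
  cancels, and invariance follows as the affine mappings form a group.
\<close>

section \<open>Distances in the hyperbolic disk and the hyperboloid model\<close>

definition pseudo_hyperbolic :: "complex \<Rightarrow> complex \<Rightarrow> real" where
  "pseudo_hyperbolic p w = cmod (w - p) / cmod (1 - cnj p * w)"

text \<open>The hyperbolic cosine of the distance of \<open>p\<close> and \<open>w\<close> in the metric of curvature -1.\<close>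

definition hyp_cosh :: "complex \<Rightarrow> complex \<Rightarrow> real" where
  "hyp_cosh p w =
     ((1 + (cmod p)\<^sup>2) * (1 + (cmod w)\<^sup>2) - 4 * Re (cnj p * w)) /
     ((1 - (cmod p)\<^sup>2) * (1 - (cmod w)\<^sup>2))"

lemma one_minus_cnj_mult_nz:
  assumes "cmod p < 1" "cmod w < 1"
  shows "1 - cnj p * w \<noteq> 0"
proof
  assume "1 - cnj p * w = 0"
  then have "cmod p * cmod w = 1"
    by (metis complex_mod_cnj eq_iff_diff_eq_0 norm_mult norm_one)
  with assms show False
    by (smt (verit) mult_left_le norm_ge_zero)
qed

text \<open>Inside the disk this compares numerator and denominator of
  \<open>pseudo_hyperbolic\<close>. For \<open>cmod p = 1\<close> it makes the two moduli equal,
  which later keeps a limit of near-optimal centres off the unit circle.\<close>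

lemma norm_one_minus_cnj_mult:
  "(cmod (1 - cnj p * w))\<^sup>2 = (cmod (w - p))\<^sup>2 + (1 - (cmod p)\<^sup>2) * (1 - (cmod w)\<^sup>2)"
  unfolding cmod_power2 by (simp add: algebra_simps power2_eq_square)

text \<open>The left side is a sum of products of a function of \<open>p\<close> and a function of
  \<open>w\<close>, which suits the hyperboloid; the right side leads to the usual distance formula
  and to positivity.\<close>

lemma hyp_cosh_numerator:
  "(1 + (cmod p)\<^sup>2) * (1 + (cmod w)\<^sup>2) - 4 * Re (cnj p * w) =
   2 * (cmod (w - p))\<^sup>2 + (1 - (cmod p)\<^sup>2) * (1 - (cmod w)\<^sup>2)"
  unfolding cmod_power2 by (simp add: algebra_simps power2_eq_square)

lemma norm_less_one_pos:
  assumes "cmod p < 1" shows "0 < 1 - (cmod p)\<^sup>2"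
  using assms by (simp add: power_less_one_iff abs_square_less_1)

lemma pseudo_hyperbolic_nonneg: "0 \<le> pseudo_hyperbolic p w"
  by (simp add: pseudo_hyperbolic_def)

lemma pseudo_hyperbolic_le_iff:
  assumes "cmod p < 1" "cmod w < 1"
  shows "pseudo_hyperbolic p w \<le> r \<longleftrightarrow> cmod (w - p) \<le> r * cmod (1 - cnj p * w)"
  using one_minus_cnj_mult_nz[OF assms] by (simp add: pseudo_hyperbolic_def field_simps)

lemma one_minus_pseudo_hyperbolic_sq:
  assumes "cmod p < 1" "cmod w < 1"
  shows "1 - (pseudo_hyperbolic p w)\<^sup>2 =
    (1 - (cmod p)\<^sup>2) * (1 - (cmod w)\<^sup>2) / (cmod (1 - cnj p * w))\<^sup>2"
  using one_minus_cnj_mult_nz[OF assms] norm_one_minus_cnj_mult[of p w]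
  by (simp add: pseudo_hyperbolic_def power_divide field_simps)

lemma pseudo_hyperbolic_less_one:
  assumes "cmod p < 1" "cmod w < 1"
  shows "pseudo_hyperbolic p w < 1"
proof -
  have "0 < 1 - (pseudo_hyperbolic p w)\<^sup>2"
    unfolding one_minus_pseudo_hyperbolic_sq[OF assms]
    using norm_less_one_pos[OF assms(1)] norm_less_one_pos[OF assms(2)] one_minus_cnj_mult_nz[OF assms]
    by simp
  then show ?thesis
    by (simp add: abs_square_less_1 pseudo_hyperbolic_nonneg)
qed

text \<open>With d the hyperbolic distance, \<open>pseudo_hyperbolic\<close> is tanh(d/2). This is
  the half-argument formula cosh d = (1 + tanh^2(d/2)) / (1 - tanh^2(d/2)) with the denominator
  cleared.\<close>

lemma hyp_cosh_pseudo_hyperbolic: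
  assumes "cmod p < 1" "cmod w < 1"
  shows "hyp_cosh p w * (1 - (pseudo_hyperbolic p w)\<^sup>2) = 1 + (pseudo_hyperbolic p w)\<^sup>2"
proof -
  have "(cmod (1 - cnj p * w))\<^sup>2 \<noteq> 0"
    using one_minus_cnj_mult_nz[OF assms] by simp
  then have "(pseudo_hyperbolic p w)\<^sup>2 * (cmod (1 - cnj p * w))\<^sup>2 = (cmod (w - p))\<^sup>2"
    by (simp add: pseudo_hyperbolic_def power_divide)
  moreover have "hyp_cosh p w * ((1 - (cmod p)\<^sup>2) * (1 - (cmod w)\<^sup>2)) =
      2 * (cmod (w - p))\<^sup>2 + (1 - (cmod p)\<^sup>2) * (1 - (cmod w)\<^sup>2)"
    unfolding hyp_cosh_def hyp_cosh_numerator
    using norm_less_one_pos[OF assms(1)] norm_less_one_pos[OF assms(2)] by simp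
  ultimately show ?thesis
    unfolding one_minus_pseudo_hyperbolic_sq[OF assms]
    using norm_one_minus_cnj_mult[of p w] \<open>_ \<noteq> 0\<close>
    by (simp add: pseudo_hyperbolic_def power_divide field_simps)
qed

lemma hyp_cosh_eq:
  assumes "cmod p < 1" "cmod w < 1"
  shows "hyp_cosh p w = 1 + 2 * (cmod (w - p))\<^sup>2 / ((1 - (cmod p)\<^sup>2) * (1 - (cmod w)\<^sup>2))"
  unfolding hyp_cosh_def hyp_cosh_numerator
  using norm_less_one_pos[OF assms(1)] norm_less_one_pos[OF assms(2)] by (simp add: add_divide_distrib)

lemma hyp_cosh_ge_one:
  assumes "cmod p < 1" "cmod w < 1"
  shows "1 \<le> hyp_cosh p w"
  unfolding hyp_cosh_eq[OF assms]
  using norm_less_one_pos[OF assms(1)] norm_less_one_pos[OF assms(2)] by simp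

lemma hyp_cosh_gt_one:
  assumes "cmod p < 1" "cmod w < 1" "p \<noteq> w"
  shows "1 < hyp_cosh p w"
  unfolding hyp_cosh_eq[OF assms(1,2)]
  using norm_less_one_pos[OF assms(1)] norm_less_one_pos[OF assms(2)] assms(3) by simp

text \<open>The map s to (1 + s) / (1 - s) is increasing on [0, 1), so both functions have the same
  disks as sublevel sets. Dilatations are measured by \<open>pseudo_hyperbolic\<close>, while the
  midpoint argument needs the linearity of \<open>hyp_cosh\<close>.\<close>

lemma hyp_cosh_le_iff:
  assumes "cmod p < 1" "cmod w < 1" "0 \<le> r" "r < 1"
  shows "hyp_cosh p w \<le> (1 + r\<^sup>2) / (1 - r\<^sup>2) \<longleftrightarrow> pseudo_hyperbolic p w \<le> r"
proof -
  define s where "s = (pseudo_hyperbolic p w)\<^sup>2"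
  have s: "0 \<le> s" "s < 1"
    using pseudo_hyperbolic_less_one[OF assms(1,2)] pseudo_hyperbolic_nonneg[of p w]
    by (auto simp: s_def abs_square_less_1)
  have r: "r\<^sup>2 < 1"
    using assms by (simp add: abs_square_less_1)
  have "hyp_cosh p w = (1 + s) / (1 - s)"
    using hyp_cosh_pseudo_hyperbolic[OF assms(1,2)] s by (simp add: s_def field_simps)
  moreover have "(1 + s) / (1 - s) \<le> (1 + r\<^sup>2) / (1 - r\<^sup>2) \<longleftrightarrow> s \<le> r\<^sup>2"
    using s r by (simp add: divide_simps algebra_simps)
  moreover have "s \<le> r\<^sup>2 \<longleftrightarrow> pseudo_hyperbolic p w \<le> r"
    unfolding s_def using assms(3) pseudo_hyperbolic_nonneg[of p w]
    by (metis power2_le_imp_le power_mono)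
  ultimately show ?thesis by simp
qed

text \<open>On the hyperboloid model \<open>hyp_cosh\<close> is bilinear, \<open>l\<close> is the Lorentz norm of the sum
  of the vectors of \<open>p\<close> and \<open>q\<close>, and \<open>m\<close> is the hyperbolic midpoint.\<close>

lemma hyp_cosh_midpoint:
  assumes p: "cmod p < 1" and q: "cmod q < 1" and "p \<noteq> q"
  obtains m l where "cmod m < 1" "2 < l"
    "\<And>w. hyp_cosh m w = (hyp_cosh p w + hyp_cosh q w) / l"
proof -
  \<comment> \<open>Stereographic projection: \<open>(t z, u z)\<close> is the point of the
    hyperboloid t^2 - |u|^2 = 1 that corresponds to \<open>z\<close>.\<close>
  define t :: "complex \<Rightarrow> real" where "t z = (1 + (cmod z)\<^sup>2) / (1 - (cmod z)\<^sup>2)" for z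
  define u :: "complex \<Rightarrow> complex" where "u z = 2 * z / of_real (1 - (cmod z)\<^sup>2)" for z
  \<comment> \<open>If \<open>z\<close> or \<open>w\<close> lies on the unit circle, both sides are
    0 because division by 0 yields 0; so the identity holds throughout the plane.\<close>
  have form: "hyp_cosh z w = t z * t w - Re (cnj (u z) * u w)" for z w
  proof -
    have "cnj (u z) * u w = 4 * (cnj z * w) / of_real ((1 - (cmod z)\<^sup>2) * (1 - (cmod w)\<^sup>2))"
      by (simp add: u_def)
    then have "Re (cnj (u z) * u w) = 4 * Re (cnj z * w) / ((1 - (cmod z)\<^sup>2) * (1 - (cmod w)\<^sup>2))"
      by (simp only: Re_divide_of_real) simp
    then show ?thesis
      by (simp add: hyp_cosh_def t_def diff_divide_distrib)
  qed
  have norm_tu: "(t z)\<^sup>2 - (cmod (u z))\<^sup>2 = 1" if "cmod z < 1" for z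
  proof -
    define e where "e = 1 - (cmod z)\<^sup>2"
    have e: "e > 0" "(cmod z)\<^sup>2 = 1 - e"
      using norm_less_one_pos[OF that] by (auto simp: e_def)
    have "(cmod (u z))\<^sup>2 = 4 * (cmod z)\<^sup>2 / e\<^sup>2"
      by (simp add: u_def e_def[symmetric] norm_divide norm_mult power_divide power_mult_distrib)
    then have "(cmod (u z))\<^sup>2 = 4 * (1 - e) / e\<^sup>2"
      by (simp only: e(2))
    moreover have "t z = (2 - e) / e"
      by (simp add: t_def e_def)
    ultimately have "(t z)\<^sup>2 - (cmod (u z))\<^sup>2 = ((2 - e)\<^sup>2 - 4 * (1 - e)) / e\<^sup>2"
      by (simp only: power_divide diff_divide_distrib[where c = "e\<^sup>2"])
    also have "(2 - e)\<^sup>2 - 4 * (1 - e) = e\<^sup>2"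
      by (simp add: algebra_simps power2_eq_square)
    finally show ?thesis
      using e(1) by simp
  qed
  have t_pos: "0 < t z" if "cmod z < 1" for z
    unfolding t_def using norm_less_one_pos[OF that] by (simp add: add_pos_nonneg)
  define T where "T = t p + t q"
  define U where "U = u p + u q"
  have TU: "T\<^sup>2 - (cmod U)\<^sup>2 = 2 + 2 * hyp_cosh p q"
    using norm_tu[OF p] norm_tu[OF q] unfolding form T_def U_def cmod_power2
    by (simp add: algebra_simps power2_eq_square)
  define l where "l = sqrt (T\<^sup>2 - (cmod U)\<^sup>2)"
  \<comment> \<open>Strictness enters here: distinct points have
    \<open>hyp_cosh p q > 1\<close>.\<close>
  have gt4: "4 < T\<^sup>2 - (cmod U)\<^sup>2"
    using hyp_cosh_gt_one[OF assms] TU by simp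
  have l: "2 < l"
    unfolding l_def using gt4 by (intro real_less_rsqrt) simp
  have l2: "l\<^sup>2 = T\<^sup>2 - (cmod U)\<^sup>2"
    unfolding l_def using gt4 by simp
  have T: "0 < T"
    unfolding T_def using t_pos p q by (simp add: add_pos_pos)
  \<comment> \<open>The inverse projection is u / (1 + t), applied to the normalized vector
    \<open>(T / l, U / l)\<close>.\<close>
  define m where "m = U / of_real (l + T)"
  have m2: "1 - (cmod m)\<^sup>2 = 2 * l / (l + T)"
  proof -
    have "cmod m = cmod U / (l + T)"
      using T l by (simp add: m_def norm_divide del: of_real_add)
    then have "(cmod m)\<^sup>2 = (T\<^sup>2 - l\<^sup>2) / (l + T)\<^sup>2"
      using l2 by (simp add: power_divide)
    also have "T\<^sup>2 - l\<^sup>2 = (T - l) * (l + T)"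
      by (simp add: algebra_simps power2_eq_square)
    finally have "(cmod m)\<^sup>2 = (T - l) / (l + T)"
      by (simp add: power2_eq_square)
    then show ?thesis
      using T l by (simp add: field_simps)
  qed
  have tm: "t m = T / l"
  proof -
    have "1 + (cmod m)\<^sup>2 = 2 - 2 * l / (l + T)"
      using m2 by simp
    also have "\<dots> = 2 * T / (l + T)"
      using T l by (simp add: field_simps)
    finally show ?thesis
      unfolding t_def m2 using T l by simp
  qed
  have um: "u m = U / of_real l"
  proof -
    have "of_real (l + T) \<noteq> (0::complex)"
      using T l by (metis add_pos_pos less_trans of_real_eq_0_iff order_less_irrefl zero_less_numeral)
    then show ?thesis
      unfolding u_def m2 unfolding m_def by simp
  qed
  show thesis
  proof (rule that)
    have "0 < 1 - (cmod m)\<^sup>2"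
      unfolding m2 using T l by simp
    then show "cmod m < 1"
      by (simp add: abs_square_less_1)
    show "2 < l" by (fact l)
    fix w
    have "Re (cnj (u m) * u w) = Re (cnj U * u w) / l"
      unfolding um by (metis Re_divide_of_real complex_cnj_complex_of_real complex_cnj_divide times_divide_eq_left)
    then show "hyp_cosh m w = (hyp_cosh p w + hyp_cosh q w) / l"
      unfolding form tm by (simp add: T_def U_def add_divide_distrib diff_divide_distrib ring_distribs)
  qed
qed


section \<open>Existence and uniqueness of hyperbolic circumcentres\<close>

definition circumradius :: "complex set \<Rightarrow> complex \<Rightarrow> real" where
  "circumradius W p = (SUP w\<in>W. pseudo_hyperbolic p w)"

lemma pseudo_hyperbolic_le_circumradius:
  assumes "W \<subseteq> ball 0 1" "cmod p < 1" "w \<in> W"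
  shows "pseudo_hyperbolic p w \<le> circumradius W p"
  unfolding circumradius_def
proof (rule cSUP_upper)
  show "bdd_above (pseudo_hyperbolic p ` W)"
    using assms pseudo_hyperbolic_less_one by (intro bdd_aboveI2[where M = 1]) (fastforce simp: less_imp_le)
qed fact

lemma circumradius_le:
  assumes "W \<noteq> {}" "\<And>w. w \<in> W \<Longrightarrow> pseudo_hyperbolic p w \<le> r"
  shows "circumradius W p \<le> r"
  unfolding circumradius_def using assms by (intro cSUP_least)

lemma circumradius_nonneg:
  assumes "W \<subseteq> ball 0 1" "W \<noteq> {}" "cmod p < 1"
  shows "0 \<le> circumradius W p"
  using assms pseudo_hyperbolic_le_circumradius[OF assms(1,3)] pseudo_hyperbolic_nonneg[of p]
  by (meson all_not_in_conv order_trans)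

text \<open>Each point of \<open>W\<close> is at pseudo-hyperbolic distance less than 1, but the
  supremum needs a uniform gap. In \<open>one_minus_pseudo_hyperbolic_sq\<close> the numerator is
  bounded below through \<open>k\<close> and the denominator above by 4, which gives the constant
  \<open>d\<close>.\<close>

lemma circumradius_less_one:
  assumes "W \<subseteq> cball 0 k" "k < 1" "W \<noteq> {}" "cmod p < 1"
  shows "circumradius W p < 1"
proof -
  have k: "0 \<le> k"
    using assms(1,3) by (metis cball_eq_empty linorder_not_le subset_empty)
  define d where "d = (1 - (cmod p)\<^sup>2) * (1 - k\<^sup>2) / 4"
  have "0 < d"
    using norm_less_one_pos[OF assms(4)] k assms(2) by (simp add: d_def abs_square_less_1)
  have "pseudo_hyperbolic p w \<le> sqrt (1 - d)" if "w \<in> W" for w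
  proof -
    have w: "cmod w \<le> k" "cmod w < 1"
      using that assms(1,2) by auto
    have "cmod (1 - cnj p * w) \<le> 1 + cmod p * cmod w"
      using norm_triangle_ineq4[of 1 "cnj p * w"] by (simp add: norm_mult)
    also have "\<dots> \<le> 2"
      using assms(4) w by (simp add: mult_le_one)
    finally have "(cmod (1 - cnj p * w))\<^sup>2 \<le> 4"
      using power_mono[of "cmod (1 - cnj p * w)" 2 2] by simp
    moreover have "1 - k\<^sup>2 \<le> 1 - (cmod w)\<^sup>2"
      using w by (simp add: power_mono)
    ultimately have "d \<le> (1 - (cmod p)\<^sup>2) * (1 - (cmod w)\<^sup>2) / (cmod (1 - cnj p * w))\<^sup>2"
      unfolding d_def
      using norm_less_one_pos[OF assms(4)] norm_less_one_pos[OF w(2)] one_minus_cnj_mult_nz[OF assms(4) w(2)]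
      by (intro frac_le mult_left_mono) auto
    then have "(pseudo_hyperbolic p w)\<^sup>2 \<le> 1 - d"
      using one_minus_pseudo_hyperbolic_sq[OF assms(4) w(2)] by simp
    then show ?thesis
      by (rule real_le_rsqrt)
  qed
  then have "circumradius W p \<le> sqrt (1 - d)"
    using assms(3) by (intro circumradius_le)
  also have "\<dots> < 1"
    using \<open>0 < d\<close> by simp
  finally show ?thesis .
qed

text \<open>Since tanh(d/2) increases with the distance d, this is the usual circumcentre of
  hyperbolic geometry.\<close>

definition circumcentre :: "complex set \<Rightarrow> complex \<Rightarrow> bool" where
  "circumcentre W p \<longleftrightarrow> is_arg_min (circumradius W) (\<lambda>p. cmod p < 1) p"

lemma circumcentre_exists:
  assumes "W \<subseteq> cball 0 k" "k < 1" "W \<noteq> {}"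
  obtains p where "circumcentre W p"
proof -
  have W: "W \<subseteq> ball 0 1"
    using assms by auto
  define r where "r = (INF p\<in>ball 0 1. circumradius W p)"
  have bdd: "bdd_below (circumradius W ` ball 0 1)"
    using circumradius_nonneg[OF W assms(3)] by (intro bdd_belowI2[where m = 0]) simp
  have r_le: "r \<le> circumradius W p" if "cmod p < 1" for p
    unfolding r_def using bdd that by (intro cINF_lower) auto
  have "r < 1"
    using r_le[of 0] circumradius_less_one[OF assms, of 0] by simp
  have "\<exists>p. cmod p < 1 \<and> circumradius W p < r + 1 / Suc n" for n
  proof -
    have "r < r + 1 / Suc n" by simp
    then show ?thesis
      unfolding r_def using bdd by (subst (asm) cINF_less_iff) auto
  qed
  then obtain x where x: "\<And>n. cmod (x n) < 1" "\<And>n. circumradius W (x n) < r + 1 / Suc n"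
    by metis
  \<comment> \<open>A minimizing sequence converges along a subsequence, at first only to a point of
    the closed disk.\<close>
  obtain p s where p: "strict_mono s" "(x \<circ> s) \<longlonglongrightarrow> p" "p \<in> cball 0 1"
    using compact_cball[of "0::complex" 1] x(1) unfolding compact_def
    by (metis dist_0_norm less_imp_le mem_cball)
  \<comment> \<open>The limit is taken with the denominator cleared, so that the inequality keeps
    its meaning if \<open>p\<close> is on the unit circle.\<close>
  have lim: "cmod (w - p) \<le> r * cmod (1 - cnj p * w)" if "w \<in> W" for w
  proof (rule LIMSEQ_le)
    show "(\<lambda>n. cmod (w - (x \<circ> s) n)) \<longlonglongrightarrow> cmod (w - p)"
      by (intro tendsto_intros p)
    have "(\<lambda>n. 1 / Suc (s n)) \<longlonglongrightarrow> 0"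
      using LIMSEQ_subseq_LIMSEQ[OF lim_inverse_n' [THEN LIMSEQ_Suc] p(1)] by (simp add: o_def)
    then have "(\<lambda>n. r + 1 / Suc (s n)) \<longlonglongrightarrow> r"
      using tendsto_add[OF tendsto_const, of _ 0 sequentially r] by simp
    then show "(\<lambda>n. (r + 1 / Suc (s n)) * cmod (1 - cnj ((x \<circ> s) n) * w)) \<longlonglongrightarrow> r * cmod (1 - cnj p * w)"
      by (intro tendsto_intros p)
    have "cmod (w - (x \<circ> s) n) \<le> (r + 1 / Suc (s n)) * cmod (1 - cnj ((x \<circ> s) n) * w)" for n
    proof -
      have "pseudo_hyperbolic (x (s n)) w \<le> r + 1 / Suc (s n)"
        using pseudo_hyperbolic_le_circumradius[OF W x(1)] x(2) that by (meson less_imp_le order_trans)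
      moreover have "cmod w < 1"
        using that W by auto
      ultimately show ?thesis
        using pseudo_hyperbolic_le_iff[OF x(1)] by simp
    qed
    then show "\<exists>N. \<forall>n\<ge>N. cmod (w - (x \<circ> s) n) \<le> (r + 1 / Suc (s n)) * cmod (1 - cnj ((x \<circ> s) n) * w)"
      by blast
  qed
  \<comment> \<open>On the unit circle the two moduli in \<open>lim\<close> would be equal and
    positive, forcing \<open>r\<close> to be at least 1.\<close>
  have "cmod p < 1"
  proof (rule ccontr)
    assume "\<not> cmod p < 1"
    then have "cmod p = 1"
      using p(3) by simp
    obtain w where w: "w \<in> W"
      using assms(3) by blast
    have "(cmod (1 - cnj p * w))\<^sup>2 = (cmod (w - p))\<^sup>2"
      using norm_one_minus_cnj_mult[of p w] \<open>cmod p = 1\<close> by simp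
    then have "cmod (1 - cnj p * w) = cmod (w - p)"
      by simp
    moreover have "0 < cmod (w - p)"
      using w W \<open>cmod p = 1\<close> by auto
    ultimately show False
      using lim[OF w] \<open>r < 1\<close> by simp
  qed
  moreover have "circumradius W p \<le> r"
    using lim W pseudo_hyperbolic_le_iff[OF \<open>cmod p < 1\<close>] assms(3) by (intro circumradius_le) auto
  ultimately show thesis
    using r_le by (intro that[of p]) (force simp: circumcentre_def is_arg_min_def)
qed

lemma circumcentre_unique:
  assumes "W \<subseteq> cball 0 k" "k < 1" "W \<noteq> {}"
    and p: "circumcentre W p" and q: "circumcentre W q"
  shows "p = q"
proof (rule ccontr)
  assume "p \<noteq> q"
  have W: "W \<subseteq> ball 0 1"
    using assms by auto
  have p1: "cmod p < 1" and q1: "cmod q < 1"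
    using p q by (auto simp: circumcentre_def is_arg_min_def)
  define r where "r = circumradius W p"
  have r_q: "circumradius W q = r"
    using p q by (auto simp: circumcentre_def is_arg_min_def r_def intro: antisym linorder_class.leI)
  have r: "0 \<le> r" "r < 1"
    unfolding r_def using circumradius_nonneg[OF W assms(3) p1] circumradius_less_one[OF assms(1-3) p1]
    by auto
  \<comment> \<open>The radius \<open>r\<close> expressed as a hyperbolic cosine; \<open>c'\<close>
    below is the bound that averaging gives at the midpoint.\<close>
  define c where "c = (1 + r\<^sup>2) / (1 - r\<^sup>2)"
  obtain m l where m: "cmod m < 1" and l: "2 < l"
    and mid: "\<And>w. hyp_cosh m w = (hyp_cosh p w + hyp_cosh q w) / l"
    using hyp_cosh_midpoint[OF p1 q1 \<open>p \<noteq> q\<close>] by blast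
  have "r\<^sup>2 < 1"
    using r by (simp add: abs_square_less_1)
  then have c: "1 \<le> c"
    by (simp add: c_def field_simps)
  define c' where "c' = 2 * c / l"
  have le_c': "hyp_cosh m w \<le> c'" if "w \<in> W" for w
  proof -
    have "cmod w < 1"
      using that W by auto
    then have "hyp_cosh p w \<le> c" "hyp_cosh q w \<le> c"
      using hyp_cosh_le_iff[OF p1 _ r] hyp_cosh_le_iff[OF q1 _ r] c_def
        pseudo_hyperbolic_le_circumradius[OF W p1 that] pseudo_hyperbolic_le_circumradius[OF W q1 that]
        r_q r_def by auto
    then show ?thesis
      unfolding mid c'_def using l by (simp add: divide_right_mono)
  qed
  obtain w where w: "w \<in> W" "cmod w < 1"
    using assms(3) W by (metis all_not_in_conv in_mono mem_ball_0)
  \<comment> \<open>The lower bound comes from an actual point of \<open>W\<close>, the strict upper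
    bound from \<open>l > 2\<close>.\<close>
  have c': "1 \<le> c'" "c' < c"
    using hyp_cosh_ge_one[OF m w(2)] le_c'[OF w(1)] l c by (linarith, simp add: c'_def field_simps)
  \<comment> \<open>This solves \<open>c' = (1 + r'^2) / (1 - r'^2)\<close>, turning
    \<open>c'\<close> back into a pseudo-hyperbolic radius; \<open>c'\<close> being at least 1 makes
    the radicand nonnegative.\<close>
  define r' where "r' = sqrt ((c' - 1) / (c' + 1))"
  have r'2: "r'\<^sup>2 = (c' - 1) / (c' + 1)" and r'0: "0 \<le> r'"
    using c' by (auto simp: r'_def)
  have "r'\<^sup>2 < r\<^sup>2"
  proof -
    have "r\<^sup>2 = (c - 1) / (c + 1)"
      using \<open>r\<^sup>2 < 1\<close> by (simp add: c_def field_simps)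
    moreover have "(c' - 1) / (c' + 1) < (c - 1) / (c + 1)"
      using c' by (simp add: field_simps)
    ultimately show ?thesis
      unfolding r'2 by simp
  qed
  then have "r' < r"
    using r(1) by (rule power2_less_imp_less)
  have c'_r': "c' = (1 + r'\<^sup>2) / (1 - r'\<^sup>2)"
    unfolding r'2 using c' by (simp add: field_simps)
  have "r' < 1"
    using \<open>r' < r\<close> r(2) by simp
  have "pseudo_hyperbolic m w \<le> r'" if "w \<in> W" for w
  proof -
    have "cmod w < 1"
      using that W by auto
    then show ?thesis
      using hyp_cosh_le_iff[OF m _ r'0 \<open>r' < 1\<close>] le_c'[OF that] c'_r' by simp
  qed
  then have "circumradius W m \<le> r'"
    by (rule circumradius_le[OF assms(3)])
  with \<open>r' < r\<close> m p show False
    by (fastforce simp: circumcentre_def is_arg_min_def r_def)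
qed

section \<open>Harmonic mappings and their dilatations under target affine mappings\<close>

lemma harmonic_decomp_affine:
  assumes "harmonic_decomp f h g"
  shows "harmonic_decomp (compose \<D> (\<lambda>w. a * w + b * cnj w + c) f)
    (\<lambda>z. a * h z + b * g z + c) (\<lambda>z. cnj a * g z + cnj b * h z)"
  using assms unfolding harmonic_decomp_def
  by (auto simp: compose_def algebra_simps intro!: holomorphic_intros)

lemma deriv_affine:
  assumes "harmonic_decomp f h g" "z \<in> \<D>"
  shows "deriv (\<lambda>z. a * h z + b * g z + c) z = a * deriv h z + b * deriv g z"
proof -
  have "(h has_field_derivative deriv h z) (at z)" "(g has_field_derivative deriv g z) (at z)"
    using assms by (auto simp: harmonic_decomp_def intro: holomorphic_derivI)
  then show ?thesis
    by (intro DERIV_imp_deriv) (auto intro!: derivative_eq_intros)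
qed

lemma deriv_affine_conjugate_part:
  assumes "harmonic_decomp f h g" "z \<in> \<D>"
  shows "deriv (\<lambda>z. cnj a * g z + cnj b * h z) z = cnj a * deriv g z + cnj b * deriv h z"
  using deriv_affine[OF assms, of "cnj b" "cnj a" 0] by (simp add: add.commute)

lemma wirtinger_affine:
  assumes "harmonic_decomp f h g" "z \<in> \<D>"
  shows "wirtinger (compose \<D> (\<lambda>w. a * w + b * cnj w + c) f) z = a * deriv h z + b * deriv g z"
  using wirtinger_eq(1)[OF harmonic_decomp_affine[OF assms(1)] assms(2)] deriv_affine[OF assms] by simp

lemma op_harmonicE:
  assumes "f \<in> op_harmonic"
  obtains h g where "harmonic_decomp f h g" "f \<in> extensional \<D>"
    "\<And>z. z \<in> \<D> \<Longrightarrow> cmod (deriv g z) < cmod (deriv h z)"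
  using assms unfolding op_harmonic_def
  by (auto simp: abs_le_square_iff power2_less_imp_less)

lemma op_affineE:
  assumes "A \<in> op_affine"
  obtains a b c where "cmod b < cmod a" "A = (\<lambda>w. a * w + b * cnj w + c)"
  using assms unfolding op_affine_def by auto

lemma op_affineI: "cmod b < cmod a \<Longrightarrow> (\<lambda>w. a * w + b * cnj w + c) \<in> op_affine"
  unfolding op_affine_def by blast

lemma affine_combination_nz:
  fixes a b x y :: complex
  assumes "cmod b < cmod a" "cmod y < cmod x"
  shows "a * x + b * y \<noteq> 0"
proof
  assume "a * x + b * y = 0"
  then have "cmod a * cmod x = cmod b * cmod y"
    by (metis add_eq_0_iff norm_minus_cancel norm_mult)
  moreover have "cmod b * cmod y < cmod a * cmod x"
    using assms by (intro mult_strict_mono') auto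
  ultimately show False by simp
qed

lemma compose_affine_op_harmonic:
  assumes "f \<in> op_harmonic" "A \<in> op_affine"
  shows "compose \<D> A f \<in> op_harmonic"
proof -
  obtain h g where f: "harmonic_decomp f h g"
    and less: "\<And>z. z \<in> \<D> \<Longrightarrow> cmod (deriv g z) < cmod (deriv h z)"
    using op_harmonicE[OF assms(1)] by metis
  obtain a b c where ab: "cmod b < cmod a" and A: "A = (\<lambda>w. a * w + b * cnj w + c)"
    using op_affineE[OF assms(2)] .
  have "0 < (cmod (a * deriv h z + b * deriv g z))\<^sup>2 - (cmod (cnj a * deriv g z + cnj b * deriv h z))\<^sup>2"
    if "z \<in> \<D>" for z
  proof -
    \<comment> \<open>Multiplicativity of the Jacobian: the first factor on the right is the
      Jacobian of the affine mapping.\<close>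
    have "(cmod (a * x + b * y))\<^sup>2 - (cmod (cnj a * y + cnj b * x))\<^sup>2 =
        ((cmod a)\<^sup>2 - (cmod b)\<^sup>2) * ((cmod x)\<^sup>2 - (cmod y)\<^sup>2)" for x y
      unfolding cmod_power2 by (simp add: algebra_simps power2_eq_square)
    moreover have "0 < (cmod a)\<^sup>2 - (cmod b)\<^sup>2" "0 < (cmod (deriv h z))\<^sup>2 - (cmod (deriv g z))\<^sup>2"
      using ab less[OF that] by (simp_all add: power_strict_mono)
    ultimately show ?thesis
      by simp
  qed
  then show ?thesis
    unfolding op_harmonic_def A
    using harmonic_decomp_affine[OF f, of a b c] deriv_affine[OF f, of _ a b c]
      deriv_affine_conjugate_part[OF f, of _ a b] compose_extensional
    by (auto intro!: exI)
qed

lemma norm_dilatation_less_one: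
  assumes "f \<in> op_harmonic" "z \<in> \<D>"
  shows "cmod (dilatation f z) < 1"
proof -
  obtain h g where f: "harmonic_decomp f h g" and "cmod (deriv g z) < cmod (deriv h z)"
    using op_harmonicE[OF assms(1)] assms(2) by metis
  then show ?thesis
    unfolding dilatation_eq[OF f assms(2)] by (simp add: norm_divide divide_less_eq)
qed

text \<open>Let p = -cnj(b/a) and let v be the dilatation of \<open>f\<close>. The new dilatation is
  (cnj a * v + cnj b) / (a + b * v), which is the unimodular constant cnj a / a times (v - p) / (1 -
  cnj p * v).\<close>

lemma norm_dilatation_affine:
  assumes "f \<in> op_harmonic" "cmod b < cmod a" "z \<in> \<D>"
  shows "cmod (dilatation (compose \<D> (\<lambda>w. a * w + b * cnj w + c) f) z) =
    pseudo_hyperbolic (- cnj (b / a)) (dilatation f z)"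
proof -
  obtain h g where f: "harmonic_decomp f h g" and less: "cmod (deriv g z) < cmod (deriv h z)"
    using op_harmonicE[OF assms(1)] assms(3) by metis
  have nz: "a \<noteq> 0" "deriv h z \<noteq> 0"
    using assms(2) less by auto
  let ?x = "deriv h z" and ?y = "deriv g z"
  have "?y / ?x - - cnj (b / a) = (cnj a * ?y + cnj b * ?x) / (cnj a * ?x)"
    using nz by (simp add: field_simps)
  moreover have "1 - cnj (- cnj (b / a)) * (?y / ?x) = (a * ?x + b * ?y) / (a * ?x)"
    using nz by (simp add: field_simps)
  ultimately have "pseudo_hyperbolic (- cnj (b / a)) (?y / ?x) =
      cmod (cnj a * ?y + cnj b * ?x) / cmod (a * ?x + b * ?y)"
    unfolding pseudo_hyperbolic_def using nz by (simp only: norm_divide norm_mult complex_mod_cnj) simp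
  then show ?thesis
    unfolding dilatation_eq[OF harmonic_decomp_affine[OF f] assms(3)] dilatation_eq[OF f assms(3)]
      deriv_affine[OF f assms(3)] deriv_affine_conjugate_part[OF f assms(3)]
    by (simp add: norm_divide)
qed

lemma disk_sup_norm_affine:
  assumes "f \<in> op_harmonic" "cmod b < cmod a"
  shows "disk_sup_norm (dilatation (compose \<D> (\<lambda>w. a * w + b * cnj w + c) f)) =
    circumradius (dilatation f ` \<D>) (- cnj (b / a))"
  unfolding disk_sup_norm_def circumradius_def image_image
  using norm_dilatation_affine[OF assms] by (intro SUP_cong) auto

lemma qc_harmonicD: "f \<in> qc_harmonic \<Longrightarrow> f \<in> op_harmonic"
  by (simp add: qc_harmonic_def)

lemma dilatation_image_subset:
  assumes "f \<in> qc_harmonic"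
  shows "dilatation f ` \<D> \<subseteq> cball 0 (disk_sup_norm (dilatation f))"
proof -
  have "bdd_above ((\<lambda>z. cmod (dilatation f z)) ` \<D>)"
    using norm_dilatation_less_one[OF qc_harmonicD[OF assms]]
    by (intro bdd_aboveI2[where M = 1]) (simp add: less_imp_le)
  then show ?thesis
    unfolding disk_sup_norm_def by (auto intro!: cSUP_upper)
qed

lemma circumradius_dilatation_less_one:
  assumes "f \<in> qc_harmonic" "cmod p < 1"
  shows "circumradius (dilatation f ` \<D>) p < 1"
  using circumradius_less_one[OF dilatation_image_subset] assms by (simp add: qc_harmonic_def)

lemma norm_affine_parameter:
  assumes "cmod b < cmod a" shows "cmod (- cnj (b / a)) < 1"
proof -
  have "cmod (b / a) < 1"
    using assms by (simp add: norm_divide divide_less_eq)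
  then show ?thesis
    by (simp only: norm_minus_cancel complex_mod_cnj)
qed

lemma compose_affine_qc_harmonic:
  assumes "f \<in> qc_harmonic" "A \<in> op_affine"
  shows "compose \<D> A f \<in> qc_harmonic"
proof -
  obtain a b c where ab: "cmod b < cmod a" and A: "A = (\<lambda>w. a * w + b * cnj w + c)"
    using op_affineE[OF assms(2)] .
  show ?thesis
    using compose_affine_op_harmonic[OF qc_harmonicD assms(2)] assms(1)
      disk_sup_norm_affine[OF qc_harmonicD ab]
      circumradius_dilatation_less_one[OF assms(1) norm_affine_parameter[OF ab]]
    by (simp add: A qc_harmonic_def)
qed

section \<open>Minimizing affine mappings as circumcentres\<close>

lemma max_dilatation_less_iff:
  assumes "f \<in> qc_harmonic" "k \<in> qc_harmonic"
  shows "max_dilatation f < max_dilatation k \<longleftrightarrow>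
    disk_sup_norm (dilatation f) < disk_sup_norm (dilatation k)"
  using assms by (simp add: max_dilatation_def qc_harmonic_def divide_simps algebra_simps)

text \<open>The parameter -cnj(b/a) ranges over the whole disk, and the maximal dilatation is a
  strictly increasing function of the circumradius at it. Both minimization problems are therefore
  the same.\<close>

lemma minimizing_iff_circumcentre:
  assumes f: "f \<in> qc_harmonic" and ab: "cmod b < cmod a"
  shows "minimizing f (\<lambda>w. a * w + b * cnj w + c) \<longleftrightarrow>
    circumcentre (dilatation f ` \<D>) (- cnj (b / a))"
proof -
  let ?R = "circumradius (dilatation f ` \<D>)"
  have less_iff: "max_dilatation (compose \<D> (\<lambda>w. a' * w + b' * cnj w + c') f) <
      max_dilatation (compose \<D> (\<lambda>w. a * w + b * cnj w + c) f) \<longleftrightarrow>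
      ?R (- cnj (b' / a')) < ?R (- cnj (b / a))" if "cmod b' < cmod a'" for a' b' c'
    using max_dilatation_less_iff[OF compose_affine_qc_harmonic[OF f op_affineI[OF that]]
        compose_affine_qc_harmonic[OF f op_affineI[OF ab]], of c' c]
      disk_sup_norm_affine[OF qc_harmonicD[OF f]] that ab by simp
  show ?thesis
  proof
    assume min: "minimizing f (\<lambda>w. a * w + b * cnj w + c)"
    have "\<not> ?R q < ?R (- cnj (b / a))" if "cmod q < 1" for q
    proof -
      \<comment> \<open>The mapping with coefficients 1 and \<open>- cnj q\<close> has parameter
        \<open>q\<close>.\<close>
      have q: "cmod (- cnj q) < cmod 1"
        using that by simp
      show ?thesis
        using min less_iff[OF q, of 0] op_affineI[OF q, of 0]
        unfolding minimizing_def is_arg_min_def by auto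
    qed
    then show "circumcentre (dilatation f ` \<D>) (- cnj (b / a))"
      using norm_affine_parameter[OF ab] by (auto simp: circumcentre_def is_arg_min_def)
  next
    assume "circumcentre (dilatation f ` \<D>) (- cnj (b / a))"
    then have "\<not> ?R (- cnj (b' / a')) < ?R (- cnj (b / a))" if "cmod b' < cmod a'" for a' b'
      using norm_affine_parameter[OF that] unfolding circumcentre_def is_arg_min_def by blast
    then show "minimizing f (\<lambda>w. a * w + b * cnj w + c)"
      unfolding minimizing_def is_arg_min_def
      using op_affineI[OF ab] less_iff by (auto elim!: op_affineE)
  qed
qed

lemma minimizing_exists:
  assumes "f \<in> qc_harmonic"
  shows "\<exists>A. minimizing f A"
proof -
  obtain p where p: "circumcentre (dilatation f ` \<D>) p"
    using circumcentre_exists[OF dilatation_image_subset[OF assms]] assms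
    by (auto simp: qc_harmonic_def)
  then have "cmod (- cnj p) < cmod 1"
    by (simp add: circumcentre_def is_arg_min_def)
  from minimizing_iff_circumcentre[OF assms this] p show ?thesis
    by auto
qed

lemma minimizing_op_affine: "minimizing f A \<Longrightarrow> A \<in> op_affine"
  by (simp add: minimizing_def is_arg_min_def)

section \<open>The normalized mapping and its independence of the choice\<close>

text \<open>The translation cancels in the difference and the factor \<open>a\<close> in the
  quotient. What remains involves only \<open>b / a\<close>, which the circumcentre
  determines.\<close>

lemma affine_normalization_eq:
  assumes f: "harmonic_decomp f h g" and "a \<noteq> 0"
  shows "affine_normalization (\<lambda>w. a * w + b * cnj w + c) f =
    (\<lambda>z\<in>\<D>. (f z - f 0 + b / a * cnj (f z - f 0)) / (deriv h 0 + b / a * deriv g 0))"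
proof -
  have "a * deriv h 0 + b * deriv g 0 = a * (deriv h 0 + b / a * deriv g 0)"
    using assms(2) by (simp add: field_simps)
  moreover have "a * f z + b * cnj (f z) + c - (a * f 0 + b * cnj (f 0) + c) =
      a * (f z - f 0 + b / a * cnj (f z - f 0))" for z
    using assms(2) by (simp add: field_simps)
  ultimately show ?thesis
    unfolding affine_normalization_def wirtinger_affine[OF f centre_in_ball[THEN iffD2, OF zero_less_one]]
    using assms(2) by (simp only: mult_divide_mult_cancel_left) simp
qed

lemma affine_normalization_minimizing_unique:
  assumes f: "f \<in> qc_harmonic" and A: "minimizing f A" and B: "minimizing f B"
  shows "affine_normalization A f = affine_normalization B f"
proof -
  obtain h g where d: "harmonic_decomp f h g"
    using op_harmonicE[OF qc_harmonicD[OF f]] by metis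
  obtain a b c where ab: "cmod b < cmod a" and A_eq: "A = (\<lambda>w. a * w + b * cnj w + c)"
    using op_affineE[OF minimizing_op_affine[OF A]] .
  obtain a' b' c' where ab': "cmod b' < cmod a'" and B_eq: "B = (\<lambda>w. a' * w + b' * cnj w + c')"
    using op_affineE[OF minimizing_op_affine[OF B]] .
  have "- cnj (b / a) = - cnj (b' / a')"
  proof (rule circumcentre_unique)
    show "dilatation f ` \<D> \<subseteq> cball 0 (disk_sup_norm (dilatation f))"
      using dilatation_image_subset[OF f] .
    show "disk_sup_norm (dilatation f) < 1"
      using f by (simp add: qc_harmonic_def)
    show "circumcentre (dilatation f ` \<D>) (- cnj (b / a))"
      "circumcentre (dilatation f ` \<D>) (- cnj (b' / a'))"
      using A B minimizing_iff_circumcentre[OF f] ab ab' by (auto simp only: A_eq B_eq)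
  qed simp
  then have "b / a = b' / a'"
    by (simp only: neg_equal_iff_equal complex_cnj_cancel_iff)
  moreover have "a \<noteq> 0" "a' \<noteq> 0"
    using ab ab' by auto
  ultimately show ?thesis
    unfolding A_eq B_eq by (simp only: affine_normalization_eq[OF d] not_False_eq_True)
qed

lemma canonical_rep_eq:
  assumes "f \<in> qc_harmonic" "minimizing f A"
  shows "\<B> f = affine_normalization A f"
  unfolding canonical_rep_def
  using affine_normalization_minimizing_unique[OF assms(1) _ assms(2)] assms(2) by (metis someI)

section \<open>The affine group and invariance of the normalized mapping\<close>

lemma op_affine_comp:
  assumes "A \<in> op_affine" "B \<in> op_affine"
  shows "A \<circ> B \<in> op_affine"
proof -
  obtain a b c where ab: "cmod b < cmod a" and A: "A = (\<lambda>w. a * w + b * cnj w + c)"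
    using op_affineE[OF assms(1)] .
  obtain a' b' c' where ab': "cmod b' < cmod a'" and B: "B = (\<lambda>w. a' * w + b' * cnj w + c')"
    using op_affineE[OF assms(2)] .
  \<comment> \<open>The coefficients of \<open>A \<circ> B\<close>; real determinants
    multiply.\<close>
  have "(cmod (a * a' + b * cnj b'))\<^sup>2 - (cmod (a * b' + b * cnj a'))\<^sup>2 =
      ((cmod a)\<^sup>2 - (cmod b)\<^sup>2) * ((cmod a')\<^sup>2 - (cmod b')\<^sup>2)"
    unfolding cmod_power2 by (simp add: algebra_simps power2_eq_square)
  moreover have "0 < (cmod a)\<^sup>2 - (cmod b)\<^sup>2" "0 < (cmod a')\<^sup>2 - (cmod b')\<^sup>2"
    using ab ab' by (simp_all add: power_strict_mono)
  ultimately have "(cmod (a * b' + b * cnj a'))\<^sup>2 < (cmod (a * a' + b * cnj b'))\<^sup>2"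
    by (smt (verit) mult_pos_pos)
  then have "cmod (a * b' + b * cnj a') < cmod (a * a' + b * cnj b')"
    by (rule power2_less_imp_less) simp
  from op_affineI[OF this, of "a * c' + b * cnj c' + c"] show ?thesis
    by (simp add: A B o_def algebra_simps)
qed

lemma op_affine_inverse:
  assumes "A \<in> op_affine"
  obtains B where "B \<in> op_affine" "A \<circ> B = id" "B \<circ> A = id"
proof -
  obtain a b c where ab: "cmod b < cmod a" and A: "A = (\<lambda>w. a * w + b * cnj w + c)"
    using op_affineE[OF assms] .
  \<comment> \<open>\<open>d\<close> is the real determinant of \<open>A\<close>. Cramer's rule,
    applied to the equation for \<open>A\<close> and its conjugate, gives the formula for
    \<open>B\<close> below.\<close>
  define d where "d = a * cnj a - b * cnj b"
  have d_real: "d = of_real ((cmod a)\<^sup>2 - (cmod b)\<^sup>2)"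
    unfolding d_def by (simp only: complex_norm_square of_real_diff)
  have "(cmod b)\<^sup>2 < (cmod a)\<^sup>2"
    using ab by (simp add: power_strict_mono)
  then have d: "d \<noteq> 0" "cnj d = d"
    unfolding d_real of_real_eq_0_iff by (linarith, simp)
  define B where "B = (\<lambda>w. (cnj a * (w - c) - b * cnj (w - c)) / d)"
  show thesis
  proof (rule that)
    have "cmod (- b / d) < cmod (cnj a / d)"
      using ab d(1) by (simp add: norm_divide divide_strict_right_mono)
    from op_affineI[OF this, of "(b * cnj c - cnj a * c) / d"] show "B \<in> op_affine"
      by (simp add: B_def diff_divide_distrib add_divide_distrib algebra_simps)
    show "A \<circ> B = id"
    proof
      fix w
      have "d * A (B w) = a * (cnj a * (w - c) - b * cnj (w - c)) + b * (a * cnj (w - c) - cnj b * (w - c)) + c * d"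
        using d by (simp add: A B_def field_simps)
      also have "\<dots> = d * w"
        by (simp add: d_def algebra_simps)
      finally show "(A \<circ> B) w = id w"
        using d(1) by simp
    qed
    show "B \<circ> A = id"
    proof
      fix w
      have "d * B (A w) = cnj a * (a * w + b * cnj w) - b * cnj (a * w + b * cnj w)"
        using d by (simp add: A B_def)
      also have "\<dots> = d * w"
        by (simp add: d_def algebra_simps)
      finally show "(B \<circ> A) w = id w"
        using d(1) by simp
    qed
  qed
qed

lemma compose_compose: "compose S A (compose S B f) = compose S (A \<circ> B) f"
  by (auto simp: compose_def)

text \<open>A competitor \<open>C\<close> for \<open>f\<close> produces the same mapping as the
  competitor \<open>C \<circ> B'\<close> for \<open>compose \<D> B f\<close>, where
  \<open>B'\<close> inverts \<open>B\<close>. So both problems run over the same set of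
  mappings.\<close>

lemma minimizing_compose:
  assumes B: "B \<in> op_affine" and A: "minimizing (compose \<D> B f) A"
  shows "minimizing f (A \<circ> B)"
proof -
  obtain B' where B': "B' \<in> op_affine" "B' \<circ> B = id"
    using op_affine_inverse[OF B] by metis
  have "\<not> max_dilatation (compose \<D> C f) < max_dilatation (compose \<D> (A \<circ> B) f)"
    if "C \<in> op_affine" for C
  proof -
    have "compose \<D> (C \<circ> B') (compose \<D> B f) = compose \<D> C f"
      by (simp only: compose_compose o_assoc[symmetric] B' comp_id)
    then show ?thesis
      using A op_affine_comp[OF that B'(1)]
      unfolding minimizing_def is_arg_min_def compose_compose by metis
  qed
  then show ?thesis
    using op_affine_comp[OF minimizing_op_affine[OF A] B] by (auto simp: minimizing_def is_arg_min_def)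
qed

lemma canonical_rep_compose:
  assumes f: "f \<in> qc_harmonic" and B: "B \<in> op_affine"
  shows "\<B> (compose \<D> B f) = \<B> f"
proof -
  obtain A where A: "minimizing (compose \<D> B f) A"
    using minimizing_exists[OF compose_affine_qc_harmonic[OF f B]] by blast
  have "affine_normalization A (compose \<D> B f) = affine_normalization (A \<circ> B) f"
    unfolding affine_normalization_def compose_compose by (auto simp: compose_def)
  then show ?thesis
    using canonical_rep_eq[OF compose_affine_qc_harmonic[OF f B] A]
      canonical_rep_eq[OF f minimizing_compose[OF B A]] by simp
qed

text \<open>The normalization follows a minimizing mapping by a similarity, hence is itself a target
  affine change. This keeps \<open>\<B> f\<close> in the equivalence class of
  \<open>f\<close>.\<close>

lemma canonical_rep_affine:
  assumes f: "f \<in> qc_harmonic"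
  obtains B where "B \<in> op_affine" "\<B> f = compose \<D> B f" "\<B> f 0 = 0" "wirtinger (\<B> f) 0 = 1"
proof -
  obtain A where A: "minimizing f A"
    using minimizing_exists[OF f] by blast
  obtain a b c where ab: "cmod b < cmod a" and A_eq: "A = (\<lambda>w. a * w + b * cnj w + c)"
    using op_affineE[OF minimizing_op_affine[OF A]] .
  obtain h g where d: "harmonic_decomp f h g" and "cmod (deriv g 0) < cmod (deriv h 0)"
    using op_harmonicE[OF qc_harmonicD[OF f]] by (metis centre_in_ball zero_less_one)
  \<comment> \<open>The Wirtinger derivative of the minimizing composition at 0. Dividing by it is
    legitimate because |b| < |a| and the dilatation of \<open>f\<close> at 0 has modulus below
    1.\<close>
  define k where "k = a * deriv h 0 + b * deriv g 0"
  have k: "k \<noteq> 0"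
    unfolding k_def by (rule affine_combination_nz) fact+
  define B where "B = (\<lambda>w. a / k * w + b / k * cnj w + (c - A (f 0)) / k)"
  have eq: "\<B> f = compose \<D> B f"
    unfolding canonical_rep_eq[OF f A] affine_normalization_def compose_def
    using wirtinger_affine[OF d, of 0 a b c]
    by (auto simp: A_eq B_def k_def[symmetric] compose_def add_divide_distrib diff_divide_distrib)
  show thesis
  proof (rule that)
    show "B \<in> op_affine"
      unfolding B_def using ab k by (intro op_affineI) (simp add: norm_divide divide_strict_right_mono)
    show "\<B> f = compose \<D> B f" by (fact eq)
    show "\<B> f 0 = 0"
      unfolding canonical_rep_eq[OF f A] affine_normalization_def by simp
    have "wirtinger (\<B> f) 0 = a / k * deriv h 0 + b / k * deriv g 0"
      unfolding eq B_def by (rule wirtinger_affine[OF d]) simp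
    also have "\<dots> = 1"
      using k by (simp add: k_def add_divide_distrib[symmetric])
    finally show "wirtinger (\<B> f) 0 = 1" .
  qed
qed

section \<open>The quotient and its section\<close>

lemma equiv_target_affine_rel: "equiv qc_harmonic target_affine_rel"
proof (rule equivI)
  show "target_affine_rel \<subseteq> qc_harmonic \<times> qc_harmonic"
    by (auto simp: target_affine_rel_def)
  show "refl_on qc_harmonic target_affine_rel"
  proof (rule refl_onI)
    fix f assume f: "f \<in> qc_harmonic"
    \<comment> \<open>Extensionality is what makes composing with the identity return
      \<open>f\<close> itself, rather than a function that agrees with it only on the disk.\<close>
    then have "f \<in> extensional \<D>"
      by (simp add: qc_harmonic_def op_harmonic_def)
    then have "f = compose \<D> id f"
      by (auto simp: compose_def extensional_def)
    moreover have "id \<in> op_affine"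
      using op_affineI[of 0 1 0] by (simp add: id_def)
    ultimately show "(f, f) \<in> target_affine_rel"
      using f by (auto simp: target_affine_rel_def)
  qed
  show "sym target_affine_rel"
  proof (rule symI)
    fix f k assume "(f, k) \<in> target_affine_rel"
    then obtain B where fk: "f \<in> qc_harmonic" "k \<in> qc_harmonic" and B: "B \<in> op_affine" "k = compose \<D> B f"
      by (auto simp: target_affine_rel_def)
    obtain B' where B': "B' \<in> op_affine" "B' \<circ> B = id"
      using op_affine_inverse[OF B(1)] by metis
    have "f \<in> extensional \<D>"
      using fk by (simp add: qc_harmonic_def op_harmonic_def)
    then have "f = compose \<D> B' k"
      unfolding B(2) compose_compose B'(2) by (auto simp: compose_def extensional_def)
    then show "(k, f) \<in> target_affine_rel"
      using fk B' by (auto simp: target_affine_rel_def)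
  qed
  show "trans target_affine_rel"
    by (rule transI) (auto simp: target_affine_rel_def compose_compose intro: op_affine_comp)
qed

lemma target_affine_rel_canonical_rep:
  assumes "f \<in> qc_harmonic"
  shows "(f, \<B> f) \<in> target_affine_rel"
  using canonical_rep_affine[OF assms] compose_affine_qc_harmonic[OF assms] assms
  by (metis (mono_tags, lifting) case_prodI mem_Collect_eq target_affine_rel_def)

lemma canonical_rep_respects: "\<B> respects target_affine_rel"
  by (rule congruentI) (auto simp: target_affine_rel_def canonical_rep_compose)

theorem theorem7p1:
  "(\<forall>f\<in>qc_harmonic.
      (\<exists>A. minimizing f A) \<and>
      (\<forall>A. minimizing f A \<longrightarrow> affine_normalization A f = \<B> f) \<and>
      (\<forall>B\<in>op_affine. \<B> (compose \<D> B f) = \<B> f) \<and>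
      \<B> f 0 = 0 \<and> wirtinger (\<B> f) 0 = 1) \<and>
   equiv qc_harmonic target_affine_rel \<and>
   (\<exists>s. quotient_section qc_harmonic target_affine_rel s \<and>
        (\<forall>f\<in>qc_harmonic. s (target_affine_rel `` {f}) = \<B> f))"
proof (intro conjI ballI allI impI)
  fix f assume f: "f \<in> qc_harmonic"
  show "\<exists>A. minimizing f A"
    using minimizing_exists[OF f] .
  show "affine_normalization A f = \<B> f" if "minimizing f A" for A
    using canonical_rep_eq[OF f that] by simp
  show "\<B> (compose \<D> B f) = \<B> f" if "B \<in> op_affine" for B
    using canonical_rep_compose[OF f that] .
  show "\<B> f 0 = 0" "wirtinger (\<B> f) 0 = 1"
    using canonical_rep_affine[OF f] by metis+
next
  show "equiv qc_harmonic target_affine_rel"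
    by (rule equiv_target_affine_rel)
next
  \<comment> \<open>The representative is arbitrary; \<open>canonical_rep_respects\<close> makes the
    value depend only on the class.\<close>
  define s where "s q = \<B> (SOME f. f \<in> q)" for q
  have s: "s (target_affine_rel `` {f}) = \<B> f" if f: "f \<in> qc_harmonic" for f
  proof -
    have "f \<in> target_affine_rel `` {f}"
      using equiv_class_self[OF equiv_target_affine_rel f] .
    then have "(f, SOME k. k \<in> target_affine_rel `` {f}) \<in> target_affine_rel"
      by (metis Image_singleton_iff someI)
    then show ?thesis
      unfolding s_def by (rule congruentD[OF canonical_rep_respects, symmetric])
  qed
  moreover have "quotient_section qc_harmonic target_affine_rel s"
  proof -
    have "s q \<in> qc_harmonic \<and> target_affine_rel `` {s q} = q" if q_in: "q \<in> qc_harmonic // target_affine_rel" for q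
    proof -
      obtain f where f: "f \<in> qc_harmonic" and q: "q = target_affine_rel `` {f}"
        using q_in by (rule quotientE)
      have rel: "(f, s q) \<in> target_affine_rel"
        unfolding q s[OF f] by (rule target_affine_rel_canonical_rep[OF f])
      then show ?thesis
        using equiv_class_eq[OF equiv_target_affine_rel rel] q by (auto simp: target_affine_rel_def)
    qed
    then show ?thesis
      by (auto simp: quotient_section_def)
  qed
  ultimately show "\<exists>s. quotient_section qc_harmonic target_affine_rel s \<and>
      (\<forall>f\<in>qc_harmonic. s (target_affine_rel `` {f}) = \<B> f)"
    by blast
qed

end
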